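(* For any $k$-graph $G$ with at least one edge and any real $p>0$, $b_{p,\mathrm{entropy}}(G)=b_p(G)$.
   Context: A $k$-graph is a finite $k$-uniform hypergraph. For a $k$-graph $G$, let $\vec{E}(G)$ be the set of tuples $(v_1,\ldots,v_k)\in V(G)^k$ with $\{v_1,\ldots,v_k\}\in E(G)$. For $p>0$, $b_p(G)$ is the maximum of $\sum_{(v_1,\ldots,v_k)\in\vec{E}(G)}x_{v_1}\cdots x_{v_k}$ over real vectors $(x_v)_{v\in V(G)}$ with $\|(x_v)\|_{\ell^p}=\left(\sum_v|x_v|^p\right)^{1/p}=1$. A random edge with uniform ordering on $G$ is a tuple of random vertices $(X_1,\ldots,X_k)\in V(G)^k$ such that $\{X_1,\ldots,X_k\}$ is always an edge of $G$ and $(X_1,\ldots,X_k)$ is symmetric, i.e. $(X_{\sigma(1)},\ldots,X_{\sigma(k)})$ has the same distribution for every permutation $\sigma$ of $\{1,\ldots,k\}$. Then $b_{p,\mathrm{entropy}}(G)$ is the largest possible value of $2^{\mathbb{H}(X_1,\ldots,X_k)-\frac kp\mathbb{H}(X_1)}$ over all random edges with uniform ordering $(X_1,\ldots,X_k)$ on $G$. Here $\mathbb{H}$ denotes Shannon entropy in base 2: $\mathbb{H}(X)=\sum_{x\in\mathrm{supp}(X)}-\mathbb{P}(X=x)\log_2\mathbb{P}(X=x)$, and $\mathbb{H}(X_1,\ldots,X_k)$ is the entropy of the tuple. (Both maxima exist by compactness.) *)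

theory Defs
  imports "HOL-Probability.Probability" "HOL-Combinatorics.Permutations"
begin

text \<open>A hypergraph is given by its vertex set \<open>V\<close> and its edge set \<open>E\<close>.\<close>

definition k_graph :: "nat \<Rightarrow> 'v set \<Rightarrow> 'v set set \<Rightarrow> bool" where
  "k_graph k V E \<longleftrightarrow> finite V \<and> (\<forall>e\<in>E. e \<subseteq> V \<and> card e = k)"

text \<open>Tuples \<open>(v\<^sub>1, \<dots>, v\<^sub>k)\<close> are lists of length \<open>k\<close>.\<close>

definition ordered_edges :: "nat \<Rightarrow> 'v set \<Rightarrow> 'v set set \<Rightarrow> 'v list set" where
  "ordered_edges k V E = {vs. length vs = k \<and> set vs \<subseteq> V \<and> set vs \<in> E}"

text \<open>Vectors indexed by \<open>V\<close> are functions on the whole type; values outside \<open>V\<close> are never used.\<close>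

definition lp_norm :: "real \<Rightarrow> 'v set \<Rightarrow> ('v \<Rightarrow> real) \<Rightarrow> real" where
  "lp_norm p V x = (\<Sum>v\<in>V. \<bar>x v\<bar> powr p) powr (1 / p)"

text \<open>\<open>GREATEST\<close> denotes a maximum (an attained supremum), and is only meaningful if one exists;
  this is shown for the two maxima below in \<open>b_p_is_maximum\<close> and \<open>b_p_entropy_is_maximum\<close>.\<close>

definition b_p :: "real \<Rightarrow> nat \<Rightarrow> 'v set \<Rightarrow> 'v set set \<Rightarrow> real" where
  "b_p p k V E = (GREATEST y. \<exists>x :: 'v \<Rightarrow> real. lp_norm p V x = 1 \<and>
     y = (\<Sum>vs\<in>ordered_edges k V E. \<Prod>v\<leftarrow>vs. x v))"

definition shannon_entropy :: "'a pmf \<Rightarrow> real" where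
  "shannon_entropy P = (\<Sum>x\<in>set_pmf P. - pmf P x * log 2 (pmf P x))"

text \<open>A random tuple enters only through its joint distribution, a \<open>pmf\<close> on lists. The list
  \<open>permute_list \<sigma> [v\<^sub>0, \<dots>]\<close> is \<open>[v\<^bsub>\<sigma> 0\<^esub>, \<dots>]\<close>, with positions counted from 0.\<close>

definition random_edge_uniform_ordering ::
    "nat \<Rightarrow> 'v set \<Rightarrow> 'v set set \<Rightarrow> 'v list pmf \<Rightarrow> bool" where
  "random_edge_uniform_ordering k V E P \<longleftrightarrow>
     set_pmf P \<subseteq> ordered_edges k V E \<and>
     (\<forall>\<sigma>. \<sigma> permutes {..<k} \<longrightarrow> map_pmf (permute_list \<sigma>) P = P)"

text \<open>\<open>map_pmf hd P\<close> is the law of the first vertex \<open>X\<^sub>1\<close>, so this is meaningful for \<open>k \<ge> 1\<close>.\<close>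

definition b_p_entropy :: "real \<Rightarrow> nat \<Rightarrow> 'v set \<Rightarrow> 'v set set \<Rightarrow> real" where
  "b_p_entropy p k V E = (GREATEST y. \<exists>P. random_edge_uniform_ordering k V E P \<and>
     y = 2 powr (shannon_entropy P - real k / p * shannon_entropy (map_pmf hd P)))"


subsection \<open>Existence of the maxima\<close>

lemma finite_ordered_edges:
  assumes "k_graph k V E"
  shows "finite (ordered_edges k V E)"
proof -
  have "finite {vs. set vs \<subseteq> V \<and> length vs = k}"
    using assms by (intro finite_lists_length_eq) (auto simp: k_graph_def)
  thus ?thesis by (rule rev_finite_subset) (auto simp: ordered_edges_def)
qed

lemma ordered_edges_nonempty:
  assumes "k_graph k V E" "E \<noteq> {}"
  shows "ordered_edges k V E \<noteq> {}"
proof -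
  obtain e where e: "e \<in> E" "e \<subseteq> V" "card e = k" "finite e"
    using assms by (auto simp: k_graph_def intro: finite_subset)
  obtain vs where "set vs = e" "length vs = k"
    using finite_distinct_list[OF e(4)] distinct_card e(3) by metis
  thus ?thesis using e by (auto simp: ordered_edges_def)
qed

lemma compact_box:
  fixes a b :: real
  shows "compact {x. \<forall>v. x v \<in> (if v \<in> A then {a..b} else {0})}" (is "compact ?K")
proof -
  have "compactin (product_topology (\<lambda>i. euclidean) UNIV)
          (PiE UNIV (\<lambda>v. if v \<in> A then {a..b} else {0::real}))"
    by (subst compactin_PiE) auto
  moreover have "PiE UNIV (\<lambda>v. if v \<in> A then {a..b} else {0::real}) = ?K"
    by (auto simp: PiE_def Pi_def)
  ultimately show ?thesis
    by (simp add: euclidean_product_topology)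
qed

lemma Greatest_attained:
  fixes S :: "real set"
  assumes "m \<in> S" "\<And>y. y \<in> S \<Longrightarrow> y \<le> m"
  shows "(GREATEST y. y \<in> S) = m"
  using assms by (intro Greatest_equality) auto

lemma continuous_on_prod_list_coords:
  "continuous_on S (\<lambda>x :: 'v \<Rightarrow> real. \<Prod>v\<leftarrow>vs. x v)"
proof (induction vs)
  case (Cons a vs)
  have "continuous_on S (\<lambda>x :: 'v \<Rightarrow> real. x a)"
    by (rule continuous_on_subset[OF continuous_on_product_coordinates]) auto
  with Cons show ?case by (auto intro!: continuous_intros)
qed auto

lemma b_p_is_maximum:
  fixes V :: "'v set"
  assumes G: "k_graph k V E" "E \<noteq> {}" "k \<ge> 1" and p: "p > 0"
  shows "\<exists>x. lp_norm p V x = 1 \<and> b_p p k V E = (\<Sum>vs\<in>ordered_edges k V E. \<Prod>v\<leftarrow>vs. x v)"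
    and "lp_norm p V x = 1 \<Longrightarrow> (\<Sum>vs\<in>ordered_edges k V E. \<Prod>v\<leftarrow>vs. x v) \<le> b_p p k V E"
proof -
  define F where "F = (\<lambda>x :: 'v \<Rightarrow> real. \<Sum>vs\<in>ordered_edges k V E. \<Prod>v\<leftarrow>vs. x v)"
  define N where "N = (\<lambda>x :: 'v \<Rightarrow> real. \<Sum>v\<in>V. \<bar>x v\<bar> powr p)"
  define K where "K = {x :: 'v \<Rightarrow> real. \<forall>v. x v \<in> (if v \<in> V then {-1..1} else {0})}"
  have fin: "finite V" using G by (simp add: k_graph_def)
  have norm_iff: "lp_norm p V x = 1 \<longleftrightarrow> N x = 1" for x :: "'v \<Rightarrow> real"
  proof
    assume "lp_norm p V x = 1"
    hence "(N x powr (1/p)) powr p = 1" by (simp add: lp_norm_def N_def)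
    moreover have "N x \<ge> 0" unfolding N_def by (intro sum_nonneg) auto
    ultimately show "N x = 1" using p by (simp add: powr_powr)
  qed (simp add: lp_norm_def N_def)
  have coord: "continuous_on S (\<lambda>x :: 'v \<Rightarrow> real. x v)" for S v
    by (rule continuous_on_subset[OF continuous_on_product_coordinates]) auto
  have contN: "continuous_on UNIV N"
    unfolding N_def using p by (intro continuous_on_sum continuous_on_powr' continuous_intros coord) auto
  have contF: "continuous_on UNIV F"
    unfolding F_def by (intro continuous_on_sum continuous_on_prod_list_coords)
  have "closed {x. N x = 1}" by (intro closed_Collect_eq contN continuous_intros)
  hence comp: "compact (K \<inter> {x. N x = 1})"
    using compact_box[of V "-1" 1] unfolding K_def by (rule compact_Int_closed[rotated])
  obtain e where e: "e \<in> E" "e \<subseteq> V" "card e = k"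
    using G by (auto simp: k_graph_def)
  then obtain v0 where "v0 \<in> V" using G(3) by fastforce
  moreover have "N (\<lambda>v. if v = v0 then 1 else 0) = (\<Sum>v\<in>V. if v = v0 then 1 else 0)"
    unfolding N_def by (intro sum.cong) auto
  ultimately have "(\<lambda>v. if v = v0 then 1 else 0) \<in> K \<inter> {x. N x = 1}"
    using fin by (auto simp: K_def)
  hence "K \<inter> {x. N x = 1} \<noteq> {}" by blast
  from continuous_attains_sup[OF comp this continuous_on_subset[OF contF subset_UNIV]]
  obtain x0 where x0: "x0 \<in> K" "N x0 = 1" "\<And>x. x \<in> K \<Longrightarrow> N x = 1 \<Longrightarrow> F x \<le> F x0"
    by blast
  have bound: "F x \<le> F x0" if "N x = 1" for x
  proof -
    define x' where "x' = (\<lambda>v. if v \<in> V then x v else 0)"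
    have "N x' = 1" using that by (simp add: N_def x'_def cong: sum.cong)
    have "\<bar>x v\<bar> \<le> 1" if "v \<in> V" for v
    proof (rule ccontr)
      assume "\<not> \<bar>x v\<bar> \<le> 1"
      hence "1 < \<bar>x v\<bar> powr p" using p by (simp add: gr_one_powr)
      also have "\<dots> \<le> N x" unfolding N_def using fin \<open>v \<in> V\<close>
        by (intro member_le_sum[of v V "\<lambda>v. \<bar>x v\<bar> powr p"]) auto
      finally show False using \<open>N x = 1\<close> by simp
    qed
    hence "x' \<in> K" by (auto simp: K_def x'_def abs_le_iff minus_le_iff)
    moreover have "F x' = F x" unfolding F_def
      by (intro sum.cong arg_cong[of _ _ prod_list] map_cong)
         (auto simp: ordered_edges_def x'_def)
    ultimately show ?thesis using x0(3) \<open>N x' = 1\<close> by metis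
  qed
  have F_apply: "(\<Sum>vs\<in>ordered_edges k V E. \<Prod>v\<leftarrow>vs. x v) = F x" for x
    by (simp add: F_def)
  have eq: "b_p p k V E = F x0"
    unfolding b_p_def F_apply norm_iff
    by (rule Greatest_attained[of _ "{y. \<exists>x. N x = 1 \<and> y = F x}", simplified])
       (use x0(2) bound in auto)
  show "\<exists>x. lp_norm p V x = 1 \<and> b_p p k V E = (\<Sum>vs\<in>ordered_edges k V E. \<Prod>v\<leftarrow>vs. x v)"
    using eq x0(2) norm_iff unfolding F_def by blast
  show "(\<Sum>vs\<in>ordered_edges k V E. \<Prod>v\<leftarrow>vs. x v) \<le> b_p p k V E" if "lp_norm p V x = 1"
    using bound that norm_iff eq unfolding F_def by metis
qed

lemma pmf_map_pmf_finite:
  assumes "finite A" "set_pmf P \<subseteq> A"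
  shows "pmf (map_pmf f P) u = (\<Sum>w | w \<in> A \<and> f w = u. pmf P w)"
proof -
  have "pmf (map_pmf f P) u = measure (measure_pmf P) (f -` {u})"
    by (rule pmf_map)
  also have "\<dots> = measure (measure_pmf P) {w \<in> A. f w = u}"
    using assms(2) by (intro measure_pmf.finite_measure_eq_AE) (auto simp: AE_measure_pmf_iff)
  also have "\<dots> = (\<Sum>w | w \<in> A \<and> f w = u. pmf P w)"
    using assms(1) by (intro measure_measure_pmf_finite) auto
  finally show ?thesis .
qed

lemma shannon_entropy_superset:
  assumes "finite A" "set_pmf P \<subseteq> A"
  shows "shannon_entropy P = (\<Sum>x\<in>A. - pmf P x * log 2 (pmf P x))"
  unfolding shannon_entropy_def using assms
  by (intro sum.mono_neutral_left) (auto simp: set_pmf_iff)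

lemma continuous_on_entropy_term: "continuous_on {0..} (\<lambda>t :: real. - t * log 2 t)"
proof -
  have lim: "((\<lambda>t :: real. - t * log 2 t) \<longlongrightarrow> 0) (at_right 0)"
    by real_asymp
  have "continuous (at t within {0..}) (\<lambda>t :: real. - t * log 2 t)" if "t \<ge> 0" for t
  proof (cases "t = 0")
    case True
    have "at (0::real) within {0..} = at_right 0"
      by (rule at_within_Icc_at_right[THEN trans[rotated], of 0 1])
         (auto intro: at_within_nhd[of _ "{..<1}"])
    thus ?thesis using lim True by (simp add: continuous_within)
  next
    case False
    with that show ?thesis by (auto intro!: continuous_intros)
  qed
  thus ?thesis by (simp add: continuous_on_eq_continuous_within)
qed

lemma random_edge_uniform_ordering_exists:
  assumes "k_graph k V E" "E \<noteq> {}"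
  shows "\<exists>P. random_edge_uniform_ordering k V E P"
proof
  let ?A = "ordered_edges k V E"
  have A: "finite ?A" "?A \<noteq> {}" using finite_ordered_edges[OF assms(1)] ordered_edges_nonempty[OF assms] by auto
  have "map_pmf (permute_list \<sigma>) (pmf_of_set ?A) = pmf_of_set ?A" if \<sigma>: "\<sigma> permutes {..<k}" for \<sigma>
  proof -
    have sub: "permute_list \<sigma> ` ?A \<subseteq> ?A"
      using \<sigma> by (auto simp: ordered_edges_def)
    have inj: "inj_on (permute_list \<sigma>) ?A"
    proof (rule inj_onI)
      fix us vs assume "us \<in> ?A" "vs \<in> ?A" and eq: "permute_list \<sigma> us = permute_list \<sigma> vs"
      hence len: "length us = k" "length vs = k" by (auto simp: ordered_edges_def)
      have "us ! i = vs ! i" if "i < k" for i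
      proof -
        have "inv \<sigma> i < k" using permutes_in_image[OF permutes_inv[OF \<sigma>], of i] that by simp
        hence "us ! (\<sigma> (inv \<sigma> i)) = vs ! (\<sigma> (inv \<sigma> i))"
          using eq len \<sigma> by (metis permute_list_nth)
        thus ?thesis using permutes_inverses(1)[OF \<sigma>] by simp
      qed
      thus "us = vs" using len by (intro nth_equalityI) auto
    qed
    show ?thesis
      using map_pmf_of_set_inj[OF inj A(2,1)] endo_inj_surj[OF A(1) sub inj] by simp
  qed
  thus "random_edge_uniform_ordering k V E (pmf_of_set ?A)"
    using A by (auto simp: random_edge_uniform_ordering_def)
qed

lemma b_p_entropy_is_maximum:
  fixes V :: "'v set"
  assumes G: "k_graph k V E" "E \<noteq> {}"
  shows "\<exists>P. random_edge_uniform_ordering k V E P \<and> b_p_entropy p k V E =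
           2 powr (shannon_entropy P - real k / p * shannon_entropy (map_pmf hd P))"
    and "random_edge_uniform_ordering k V E P \<Longrightarrow>
           2 powr (shannon_entropy P - real k / p * shannon_entropy (map_pmf hd P))
             \<le> b_p_entropy p k V E"
proof -
  define A where "A = ordered_edges k V E"
  define R where "R = random_edge_uniform_ordering k V E"
  define H where "H = (\<lambda>P :: 'v list pmf. 2 powr (shannon_entropy P - real k / p * shannon_entropy (map_pmf hd P)))"
  define h where "h = (\<lambda>t :: real. - t * log 2 t)"
  define Q where "Q = (\<lambda>f :: 'v list \<Rightarrow> 'v list. \<lambda>q :: 'v list \<Rightarrow> real. \<lambda>u. \<Sum>w | w \<in> A \<and> f w = u. q w)"
  define F where "F = (\<lambda>q :: 'v list \<Rightarrow> real. 2 powr ((\<Sum>w\<in>A. h (q w)) -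
      real k / p * (\<Sum>u\<in>hd ` A. h (\<Sum>w | w \<in> A \<and> hd w = u. q w))))"
  define B where "B = {q :: 'v list \<Rightarrow> real. \<forall>w. q w \<in> (if w \<in> A then {0..1} else {0})}"
  define C where "C = B \<inter> {q. (\<Sum>w\<in>A. q w) = 1} \<inter>
      (\<Inter>\<sigma>\<in>{\<sigma>. \<sigma> permutes {..<k}}. \<Inter>u. {q. Q (permute_list \<sigma>) q u = q u})"
  have A: "finite A" using finite_ordered_edges[OF G(1)] by (simp add: A_def)
  have coord: "continuous_on S (\<lambda>q :: 'v list \<Rightarrow> real. q v)" for S v
    by (rule continuous_on_subset[OF continuous_on_product_coordinates]) auto
  have "compact B" unfolding B_def by (rule compact_box)
  moreover have "closed {q :: 'v list \<Rightarrow> real. (\<Sum>w\<in>A. q w) = 1}"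
    by (intro closed_Collect_eq continuous_intros coord)
  moreover have "closed {q. Q f q u = q u}" for f u
    unfolding Q_def by (intro closed_Collect_eq continuous_intros coord)
  ultimately have comp: "compact C"
    unfolding C_def by (intro compact_Int_closed closed_INT ballI) auto
  have toC: "pmf P \<in> C \<and> F (pmf P) = H P" if "R P" for P
  proof -
    have sub: "set_pmf P \<subseteq> A" and
      sym: "\<And>\<sigma>. \<sigma> permutes {..<k} \<Longrightarrow> map_pmf (permute_list \<sigma>) P = P"
      using that by (auto simp: R_def random_edge_uniform_ordering_def A_def)
    have "pmf P \<in> B" using sub by (auto simp: B_def pmf_le_1 set_pmf_iff)
    moreover have "Q f (pmf P) u = pmf (map_pmf f P) u" for f u
      by (simp add: Q_def pmf_map_pmf_finite[OF A sub])
    moreover have "(\<Sum>w\<in>A. pmf P w) = 1" by (rule sum_pmf_eq_1[OF A sub])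
    ultimately have "pmf P \<in> C" using sym by (auto simp: C_def)
    moreover have "shannon_entropy (map_pmf hd P) = (\<Sum>u\<in>hd ` A. h (\<Sum>w | w \<in> A \<and> hd w = u. pmf P w))"
      using shannon_entropy_superset[of "hd ` A" "map_pmf hd P"] A sub
      by (auto simp: pmf_map_pmf_finite[OF A sub] h_def image_mono)
    moreover have "shannon_entropy P = (\<Sum>w\<in>A. h (pmf P w))"
      using shannon_entropy_superset[OF A sub] by (simp add: h_def)
    ultimately show ?thesis by (simp add: F_def H_def)
  qed
  have fromC: "\<exists>P. R P \<and> q = pmf P" if "q \<in> C" for q
  proof -
    have nn: "q w \<ge> 0" and out: "w \<notin> A \<Longrightarrow> q w = 0" for w
      using that by (auto simp: C_def B_def split: if_splits)
    have "(\<integral>\<^sup>+w. ennreal (q w) \<partial>count_space UNIV) = (\<Sum>w\<in>A. ennreal (q w))"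
      using A out by (intro nn_integral_count_space'[of A]) auto
    also have "\<dots> = ennreal (\<Sum>w\<in>A. q w)" using nn by (intro sum_ennreal) auto
    also have "\<dots> = 1" using that by (simp add: C_def)
    finally have int: "(\<integral>\<^sup>+w. ennreal (q w) \<partial>count_space UNIV) = 1" .
    define P where "P = embed_pmf q"
    have P: "pmf P w = q w" for w unfolding P_def by (rule pmf_embed_pmf[OF nn int])
    have sub: "set_pmf P \<subseteq> A" using out P by (force simp: set_pmf_iff)
    have "map_pmf (permute_list \<sigma>) P = P" if "\<sigma> permutes {..<k}" for \<sigma>
    proof (rule pmf_eqI)
      fix u
      have "Q (permute_list \<sigma>) q u = q u" using that \<open>q \<in> C\<close> by (auto simp: C_def)
      thus "pmf (map_pmf (permute_list \<sigma>) P) u = pmf P u"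
        by (simp add: pmf_map_pmf_finite[OF A sub] P Q_def)
    qed
    thus ?thesis using sub P
      by (auto simp: R_def random_edge_uniform_ordering_def A_def fun_eq_iff intro!: exI[of _ P])
  qed
  have nnC: "q w \<ge> 0" if "q \<in> C" for q w
    using fromC[OF that] by auto
  have hsum: "continuous_on C (\<lambda>q. h (\<Sum>w\<in>I. q w))" for I
  proof -
    have "continuous_on C (\<lambda>q. \<Sum>w\<in>I. q w)" by (intro continuous_on_sum coord)
    moreover have "(\<lambda>q. \<Sum>w\<in>I. q w) ` C \<subseteq> {0..}"
      using nnC by (force intro: sum_nonneg)
    ultimately show ?thesis
      unfolding h_def by (rule continuous_on_compose2[OF continuous_on_entropy_term])
  qed
  have hcoord: "continuous_on C (\<lambda>q. h (q w))" for w
    using hsum[of "{w}"] by simp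
  have contF: "continuous_on C F"
    unfolding F_def
    by (intro continuous_on_powr continuous_on_diff continuous_on_mult continuous_on_const
        continuous_on_sum hsum hcoord) simp
  obtain P1 where "R P1" using random_edge_uniform_ordering_exists[OF G] by (auto simp: R_def)
  hence "C \<noteq> {}" using toC by blast
  from continuous_attains_sup[OF comp this contF]
  obtain q where q: "q \<in> C" "\<And>q'. q' \<in> C \<Longrightarrow> F q' \<le> F q" by blast
  obtain P0 where P0: "R P0" "q = pmf P0" using fromC[OF q(1)] by blast
  have bound: "H P \<le> H P0" if "R P" for P
    using q(2)[of "pmf P"] toC[OF that] toC[OF P0(1)] P0(2) by simp
  have H_apply: "2 powr (shannon_entropy P - real k / p * shannon_entropy (map_pmf hd P)) = H P" for P
    by (simp add: H_def)
  have eq: "b_p_entropy p k V E = H P0"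
    unfolding b_p_entropy_def H_apply R_def[symmetric]
    by (rule Greatest_attained[of _ "{y. \<exists>P. R P \<and> y = H P}", simplified])
       (use P0(1) bound in auto)
  show "\<exists>P. random_edge_uniform_ordering k V E P \<and> b_p_entropy p k V E =
           2 powr (shannon_entropy P - real k / p * shannon_entropy (map_pmf hd P))"
    using eq P0(1) unfolding H_def R_def by blast
  show "2 powr (shannon_entropy P - real k / p * shannon_entropy (map_pmf hd P))
          \<le> b_p_entropy p k V E" if "random_edge_uniform_ordering k V E P"
    using bound[of P] that eq unfolding H_def R_def by simp
qed

end

theory Submission
  imports Defs
begin

text \<open>Both inequalities are instances of the Gibbs inequality: for a finitely supported law \<open>P\<close> and
  weights \<open>q > 0\<close> on its support,
  \<open>H(P) + \<Sum>\<^sub>w P(w) log q(w) \<le> log (\<Sum>\<^sub>w q(w))\<close> (\<open>shannon_entropy_plus_expectation_log_le\<close>).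
  The bridge between the joint law \<open>P\<close> of a random edge and the law \<open>m\<close> of its first vertex is
  symmetry: all \<open>k\<close> coordinates have law \<open>m\<close>, so the expectation of \<open>\<Sum>\<^sub>i f(X\<^sub>i)\<close> is \<open>k\<close> times
  that of \<open>f\<close> under \<open>m\<close> (\<open>expectation_sum_list_random_edge\<close>).

  For a random edge, the vector \<open>x\<^sub>v = m(v)\<^sup>1\<^sup>/\<^sup>p\<close> has norm 1, and with the edge weights
  \<open>q(w) = \<Prod>\<^sub>i x(w\<^sub>i)\<close> the expectation of \<open>log q\<close> is \<open>- (k/p) H(m)\<close>. The Gibbs inequality for \<open>P\<close>
  and \<open>q\<close> therefore says that the entropic objective at \<open>P\<close> is at most the polynomial
  \<open>\<Sum>\<^sub>w \<Prod>\<^sub>i x(w\<^sub>i)\<close> at \<open>x\<close>.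

  Conversely, from a nonnegative vector \<open>x\<close> of norm 1 at which the polynomial has a value \<open>b > 0\<close>,
  form the random edge with \<open>P(w) = (\<Prod>\<^sub>i x(w\<^sub>i)) / b\<close>. Then
  \<open>H(P) - (k/p) H(m) = log b - (k/p) (H(m) + \<Sum>\<^sub>v m(v) log (x\<^sub>v\<^sup>p))\<close>, and the last bracket is at
  most \<open>log 1 = 0\<close> by the Gibbs inequality for \<open>m\<close> and the probability vector \<open>x\<^sub>v\<^sup>p\<close>. At a
  maximiser \<open>x\<close> this gives the second inequality.\<close>


section \<open>Entropy of finitely supported laws\<close>

lemma expectation_pmf_finite:
  assumes "finite (set_pmf P)"
  shows "measure_pmf.expectation P f = (\<Sum>w\<in>set_pmf P. pmf P w * (f w :: real))"
  by (subst integral_measure_pmf[of "set_pmf P"]) (use assms in auto)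

lemma shannon_entropy_eq_expectation:
  assumes "finite (set_pmf P)"
  shows "shannon_entropy P = - measure_pmf.expectation P (\<lambda>w. log 2 (pmf P w))"
  by (simp add: expectation_pmf_finite[OF assms] shannon_entropy_def sum_negf)

text \<open>The Gibbs inequality, from \<open>ln t \<le> t - 1\<close> applied to the ratios \<open>t = q(w) / (P(w) Z)\<close>, where
  \<open>Z\<close> is the total weight.\<close>

lemma shannon_entropy_plus_expectation_log_le:
  fixes q :: "'a \<Rightarrow> real"
  assumes fin: "finite (set_pmf P)" and q: "\<And>w. w \<in> set_pmf P \<Longrightarrow> q w > 0"
  shows "shannon_entropy P + measure_pmf.expectation P (\<lambda>w. log 2 (q w))
           \<le> log 2 (\<Sum>w\<in>set_pmf P. q w)"
proof -
  define Z where "Z = (\<Sum>w\<in>set_pmf P. q w)"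
  have Z: "Z > 0" unfolding Z_def using fin q set_pmf_not_empty by (intro sum_pos) auto
  have one: "(\<Sum>w\<in>set_pmf P. pmf P w) = 1" by (rule sum_pmf_eq_1[OF fin]) auto
  have le: "pmf P w * (ln (q w) - ln (pmf P w) - ln Z) \<le> q w / Z - pmf P w" if "w \<in> set_pmf P" for w
  proof -
    have pos: "pmf P w > 0" using that by (simp add: pmf_positive)
    have "ln (q w / (pmf P w * Z)) \<le> q w / (pmf P w * Z) - 1"
      using q[OF that] pos Z by (intro ln_le_minus_one) auto
    also have "ln (q w / (pmf P w * Z)) = ln (q w) - ln (pmf P w) - ln Z"
      using q[OF that] pos Z by (simp add: ln_div ln_mult)
    finally have "pmf P w * (ln (q w) - ln (pmf P w) - ln Z)
        \<le> pmf P w * (q w / (pmf P w * Z) - 1)"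
      using pos by (intro mult_left_mono) auto
    also have "\<dots> = q w / Z - pmf P w" using pos Z by (simp add: field_simps)
    finally show ?thesis .
  qed
  have "(\<Sum>w\<in>set_pmf P. pmf P w * (ln (q w) - ln (pmf P w) - ln Z))
      \<le> (\<Sum>w\<in>set_pmf P. q w / Z - pmf P w)"
    by (intro sum_mono le)
  also have "\<dots> = 0"
    using Z one by (simp add: sum_subtractf flip: sum_divide_distrib Z_def)
  finally have "(\<Sum>w\<in>set_pmf P. pmf P w * ln (q w)) - (\<Sum>w\<in>set_pmf P. pmf P w * ln (pmf P w)) \<le> ln Z"
    using one by (simp add: right_diff_distrib sum_subtractf flip: sum_distrib_right)
  hence "((\<Sum>w\<in>set_pmf P. pmf P w * ln (q w)) - (\<Sum>w\<in>set_pmf P. pmf P w * ln (pmf P w))) / ln 2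
      \<le> ln Z / ln 2"
    by (intro divide_right_mono) auto
  thus ?thesis
    by (simp add: expectation_pmf_finite[OF fin] shannon_entropy_def log_def sum_negf
        diff_divide_distrib sum_divide_distrib flip: Z_def)
qed


section \<open>Marginals of a random edge\<close>

lemma random_edge_finite:
  assumes "k_graph k V E" "random_edge_uniform_ordering k V E P"
  shows "finite (set_pmf P)"
  using finite_ordered_edges[OF assms(1)] assms(2)
  by (auto simp: random_edge_uniform_ordering_def intro: finite_subset)

lemma random_edge_support:
  assumes "random_edge_uniform_ordering k V E P" "w \<in> set_pmf P"
  shows "length w = k" "set w \<subseteq> V" "w \<in> ordered_edges k V E"
  using assms by (auto simp: random_edge_uniform_ordering_def ordered_edges_def)

text \<open>Apply the symmetry of \<open>P\<close> to the transposition of the positions 0 and \<open>i\<close>.\<close>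

lemma random_edge_marginal:
  assumes P: "random_edge_uniform_ordering k V E P" and i: "i < k"
  shows "map_pmf (\<lambda>w. w ! i) P = map_pmf hd P"
proof -
  let ?s = "Transposition.transpose 0 i"
  have s: "?s permutes {..<k}" using i by (intro permutes_swap_id) auto
  have "map_pmf hd P = map_pmf hd (map_pmf (permute_list ?s) P)"
    using P s by (simp add: random_edge_uniform_ordering_def)
  also have "\<dots> = map_pmf (\<lambda>w. hd (permute_list ?s w)) P"
    by (simp add: map_pmf_comp)
  also have "\<dots> = map_pmf (\<lambda>w. w ! i) P"
  proof (rule map_pmf_cong[OF refl])
    fix w assume "w \<in> set_pmf P"
    hence len: "length w = k" using random_edge_support[OF P] by blast
    hence "hd (permute_list ?s w) = permute_list ?s w ! 0"
      using i by (intro hd_conv_nth) (auto simp flip: length_0_conv)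
    also have "\<dots> = w ! i" using s len i by (simp add: permute_list_nth)
    finally show "hd (permute_list ?s w) = w ! i" .
  qed
  finally show ?thesis ..
qed

lemma random_edge_vertex_in_marginal:
  assumes P: "random_edge_uniform_ordering k V E P" and w: "w \<in> set_pmf P" "v \<in> set w"
  shows "v \<in> set_pmf (map_pmf hd P)"
proof -
  obtain i where i: "i < k" "v = w ! i"
    using w random_edge_support(1)[OF P w(1)] by (auto simp: in_set_conv_nth)
  show ?thesis unfolding random_edge_marginal[OF P i(1), symmetric] using w i by auto
qed

lemma expectation_sum_list_random_edge:
  fixes f :: "'v \<Rightarrow> real"
  assumes G: "k_graph k V E" and P: "random_edge_uniform_ordering k V E P"
  shows "measure_pmf.expectation P (\<lambda>w. \<Sum>v\<leftarrow>w. f v)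
           = real k * measure_pmf.expectation (map_pmf hd P) f"
proof -
  have fin: "finite (set_pmf P)" by (rule random_edge_finite[OF G P])
  have "measure_pmf.expectation P (\<lambda>w. \<Sum>v\<leftarrow>w. f v)
      = (\<Sum>w\<in>set_pmf P. \<Sum>i<k. pmf P w * f (w ! i))"
    unfolding expectation_pmf_finite[OF fin]
    by (intro sum.cong refl)
       (auto simp: sum_list_sum_nth random_edge_support[OF P] sum_distrib_left atLeast0LessThan)
  also have "\<dots> = (\<Sum>i<k. measure_pmf.expectation P (\<lambda>w. f (w ! i)))"
    by (subst sum.swap) (simp add: expectation_pmf_finite[OF fin])
  also have "\<dots> = (\<Sum>i<k. measure_pmf.expectation (map_pmf (\<lambda>w. w ! i) P) f)"
    by simp
  also have "\<dots> = (\<Sum>i<k. measure_pmf.expectation (map_pmf hd P) f)"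
    by (intro sum.cong refl) (simp only: random_edge_marginal[OF P] lessThan_iff)
  finally show ?thesis by simp
qed

lemma log_prod_list:
  fixes x :: "'a \<Rightarrow> real"
  assumes "\<And>v. v \<in> set w \<Longrightarrow> x v > 0"
  shows "(\<Prod>v\<leftarrow>w. x v) > 0 \<and> log 2 (\<Prod>v\<leftarrow>w. x v) = (\<Sum>v\<leftarrow>w. log 2 (x v))"
  using assms
proof (induction w)
  case (Cons a w)
  have "x a > 0" using Cons.prems by simp
  moreover have "(\<Prod>v\<leftarrow>w. x v) > 0 \<and> log 2 (\<Prod>v\<leftarrow>w. x v) = (\<Sum>v\<leftarrow>w. log 2 (x v))"
    using Cons by auto
  ultimately show ?case by (simp add: log_mult)
qed simp

lemma prod_list_pos_iff_nonneg:
  fixes x :: "'a \<Rightarrow> real"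
  assumes "\<And>v. x v \<ge> 0"
  shows "(\<Prod>v\<leftarrow>w. x v) > 0 \<longleftrightarrow> (\<forall>v\<in>set w. x v > 0)"
  using assms by (induction w) (auto simp: zero_less_mult_iff not_less[symmetric])

lemma expectation_log_prod_random_edge:
  assumes G: "k_graph k V E" and P: "random_edge_uniform_ordering k V E P"
    and x: "\<And>w v. w \<in> set_pmf P \<Longrightarrow> v \<in> set w \<Longrightarrow> x v > 0"
  shows "measure_pmf.expectation P (\<lambda>w. log 2 (\<Prod>v\<leftarrow>w. x v))
           = real k * measure_pmf.expectation (map_pmf hd P) (\<lambda>v. log 2 (x v))"
proof -
  have "measure_pmf.expectation P (\<lambda>w. log 2 (\<Prod>v\<leftarrow>w. x v))
      = measure_pmf.expectation P (\<lambda>w. \<Sum>v\<leftarrow>w. log 2 (x v))"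
    by (intro integral_cong_AE) (auto simp: AE_measure_pmf_iff log_prod_list[OF x])
  thus ?thesis using expectation_sum_list_random_edge[OF G P] by simp
qed


section \<open>From a random edge to a vector\<close>

text \<open>The witness is \<open>x\<^sub>v = \<P>(X\<^sub>1 = v)\<^sup>1\<^sup>/\<^sup>p\<close>.\<close>

lemma entropy_le_polynomial_at_marginal:
  fixes V :: "'v set"
  assumes k: "k \<ge> 1" and G: "k_graph k V E" and p: "p > 0"
    and P: "random_edge_uniform_ordering k V E P"
  obtains x where "lp_norm p V x = 1"
    "2 powr (shannon_entropy P - real k / p * shannon_entropy (map_pmf hd P))
       \<le> (\<Sum>vs\<in>ordered_edges k V E. \<Prod>v\<leftarrow>vs. x v)"
proof
  define m where "m = map_pmf hd P"
  define x where "x = (\<lambda>v. pmf m v powr (1 / p))"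
  have finP: "finite (set_pmf P)" by (rule random_edge_finite[OF G P])
  hence finm: "finite (set_pmf m)" by (simp add: m_def)
  have "hd w \<in> V" if "w \<in> set_pmf P" for w
    using random_edge_support[OF P that] k hd_in_set[of w] by (cases w) auto
  hence "set_pmf m \<subseteq> V" by (auto simp: m_def)
  hence "(\<Sum>v\<in>V. pmf m v) = 1" using G by (intro sum_pmf_eq_1) (auto simp: k_graph_def)
  thus "lp_norm p V x = 1" using p by (simp add: lp_norm_def x_def powr_powr)
  have pos: "x v > 0" if "w \<in> set_pmf P" "v \<in> set w" for w v
    using pmf_positive[OF random_edge_vertex_in_marginal[OF P that]] by (simp add: x_def m_def)
  have posw: "(\<Prod>v\<leftarrow>w. x v) > 0" if "w \<in> set_pmf P" for w
    using log_prod_list[of w x] pos[OF that] by blast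
  have "measure_pmf.expectation m (\<lambda>v. log 2 (x v))
      = measure_pmf.expectation m (\<lambda>v. 1 / p * log 2 (pmf m v))"
    by (intro integral_cong_AE) (auto simp: AE_measure_pmf_iff x_def log_powr set_pmf_iff)
  also have "\<dots> = - (shannon_entropy m / p)"
    by (simp add: shannon_entropy_eq_expectation[OF finm])
  finally have "measure_pmf.expectation P (\<lambda>w. log 2 (\<Prod>v\<leftarrow>w. x v)) = - (real k / p * shannon_entropy m)"
    using expectation_log_prod_random_edge[OF G P pos] by (simp add: m_def)
  hence "shannon_entropy P - real k / p * shannon_entropy m \<le> log 2 (\<Sum>w\<in>set_pmf P. \<Prod>v\<leftarrow>w. x v)"
    using shannon_entropy_plus_expectation_log_le[OF finP, of "\<lambda>w. \<Prod>v\<leftarrow>w. x v"] posw by simp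
  moreover have "(\<Sum>w\<in>set_pmf P. \<Prod>v\<leftarrow>w. x v) > 0"
    using finP posw set_pmf_not_empty by (intro sum_pos) auto
  ultimately have "2 powr (shannon_entropy P - real k / p * shannon_entropy m)
      \<le> (\<Sum>w\<in>set_pmf P. \<Prod>v\<leftarrow>w. x v)"
    by (simp add: le_log_iff)
  also have "\<dots> \<le> (\<Sum>w\<in>ordered_edges k V E. \<Prod>v\<leftarrow>w. x v)"
    using random_edge_support(3)[OF P] finite_ordered_edges[OF G]
    by (intro sum_mono2) (auto intro!: prod_list_nonneg simp: x_def)
  finally show "2 powr (shannon_entropy P - real k / p * shannon_entropy (map_pmf hd P))
      \<le> (\<Sum>vs\<in>ordered_edges k V E. \<Prod>v\<leftarrow>vs. x v)" by (simp add: m_def)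
qed


section \<open>From a vector to a random edge\<close>

text \<open>The Gibbs distribution on ordered edges. It is symmetric because the product of the \<open>x\<close>-values
  does not see the order.\<close>

lemma random_edge_proportional_to_product:
  fixes x :: "'v \<Rightarrow> real"
  assumes G: "k_graph k V E" and x: "\<And>v. x v \<ge> 0"
    and b: "b = (\<Sum>vs\<in>ordered_edges k V E. \<Prod>v\<leftarrow>vs. x v)" "b > 0"
  obtains P where "random_edge_uniform_ordering k V E P"
    "\<And>w. w \<in> ordered_edges k V E \<Longrightarrow> pmf P w = (\<Prod>v\<leftarrow>w. x v) / b"
proof
  define A where "A = ordered_edges k V E"
  define q where "q = (\<lambda>w. if w \<in> A then (\<Prod>v\<leftarrow>w. x v) / b else 0)"
  have A: "finite A" using finite_ordered_edges[OF G] by (simp add: A_def)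
  have nn: "q w \<ge> 0" for w
    using x b(2) by (auto simp: q_def intro!: divide_nonneg_pos prod_list_nonneg)
  have "(\<integral>\<^sup>+w. ennreal (q w) \<partial>count_space UNIV) = (\<Sum>w\<in>A. ennreal (q w))"
    using A by (intro nn_integral_count_space'[of A]) (auto simp: q_def)
  also have "\<dots> = ennreal (\<Sum>w\<in>A. q w)" using nn by (intro sum_ennreal) auto
  also have "(\<Sum>w\<in>A. q w) = 1"
    using b by (simp add: q_def A_def flip: sum_divide_distrib)
  finally have int: "(\<integral>\<^sup>+w. ennreal (q w) \<partial>count_space UNIV) = 1" by simp
  define P where "P = embed_pmf q"
  have P: "pmf P w = q w" for w unfolding P_def by (rule pmf_embed_pmf[OF nn int])
  have sub: "set_pmf P \<subseteq> A" by (metis (no_types, lifting) P q_def set_pmf_iff subsetI)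
  have "map_pmf (permute_list s) P = P" if s: "s permutes {..<k}" for s
  proof (rule pmf_eqI)
    fix u
    have len: "length w = k" if "w \<in> A" for w using that by (simp add: A_def ordered_edges_def)
    have inv: "inv s permutes {..<k}" using s by (rule permutes_inv)
    have closed: "permute_list t w \<in> A" if "w \<in> A" "t permutes {..<k}" for t w
      using that by (auto simp: A_def ordered_edges_def)
    have fibre: "{w. w \<in> A \<and> permute_list s w = u} = (if u \<in> A then {permute_list (inv s) u} else {})"
    proof (cases "u \<in> A")
      case True
      have "permute_list s (permute_list (inv s) u) = permute_list (inv s \<circ> s) u"
        using s len[OF True] by (intro permute_list_compose[symmetric]) auto
      hence "permute_list s (permute_list (inv s) u) = u"
        by (simp add: permutes_inv_o[OF s])
      moreover have "w = permute_list (inv s) u" if "w \<in> A" "permute_list s w = u" for w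
      proof -
        have "permute_list (inv s) (permute_list s w) = permute_list (s \<circ> inv s) w"
          using inv len[OF that(1)] by (intro permute_list_compose[symmetric]) auto
        thus ?thesis using that(2) by (simp add: permutes_inv_o[OF s])
      qed
      ultimately have "{w. w \<in> A \<and> permute_list s w = u} = {permute_list (inv s) u}"
        using closed[OF True inv] by blast
      thus ?thesis using True by simp
    qed (use closed[OF _ s] in auto)
    have "prod_list (map x (permute_list (inv s) u)) = prod_list (map x u)" if "u \<in> A"
    proof -
      have "mset (permute_list (inv s) u) = mset u" using inv len[OF that] by simp
      thus ?thesis by (metis mset_map prod_mset_prod_list)
    qed
    hence "pmf (map_pmf (permute_list s) P) u = q u"
      using closed[OF _ inv] by (simp add: pmf_map_pmf_finite[OF A sub] fibre P q_def)
    thus "pmf (map_pmf (permute_list s) P) u = pmf P u" by (simp add: P)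
  qed
  thus "random_edge_uniform_ordering k V E P"
    using sub by (simp add: random_edge_uniform_ordering_def A_def)
  show "pmf P w = (\<Prod>v\<leftarrow>w. x v) / b" if "w \<in> ordered_edges k V E" for w
    using that by (simp add: P q_def A_def)
qed

lemma lp_norm_eq_1_imp:
  assumes "p > 0" "lp_norm p V x = 1"
  shows "(\<Sum>v\<in>V. \<bar>x v\<bar> powr p) = 1"
proof -
  have "((\<Sum>v\<in>V. \<bar>x v\<bar> powr p) powr (1/p)) powr p = 1" using assms by (simp add: lp_norm_def)
  moreover have "(\<Sum>v\<in>V. \<bar>x v\<bar> powr p) \<ge> 0" by (intro sum_nonneg) auto
  ultimately show ?thesis using assms(1) by (simp add: powr_powr)
qed

text \<open>The entropy of the Gibbs distribution is \<open>log b - k L\<close>, where \<open>L\<close> is the expectation of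
  \<open>log x\<close> at its first vertex, so the entropic objective has logarithm
  \<open>log b - (k/p) (H(m) + p L)\<close>; the constraint \<open>\<Sum>\<^sub>v x\<^sub>v\<^sup>p = 1\<close> makes \<open>H(m) + p L\<close>
  nonpositive.\<close>

lemma polynomial_le_entropy_of_gibbs:
  fixes V :: "'v set"
  assumes k: "k \<ge> 1" and G: "k_graph k V E" and p: "p > 0"
    and x: "\<And>v. x v \<ge> 0" "lp_norm p V x = 1"
    and b: "b = (\<Sum>vs\<in>ordered_edges k V E. \<Prod>v\<leftarrow>vs. x v)" "b > 0"
  obtains P where "random_edge_uniform_ordering k V E P"
    "b \<le> 2 powr (shannon_entropy P - real k / p * shannon_entropy (map_pmf hd P))"
proof -
  obtain P where P: "random_edge_uniform_ordering k V E P"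
    and pmfP: "\<And>w. w \<in> ordered_edges k V E \<Longrightarrow> pmf P w = (\<Prod>v\<leftarrow>w. x v) / b"
    using random_edge_proportional_to_product[OF G x(1) b] by blast
  define m where "m = map_pmf hd P"
  have finP: "finite (set_pmf P)" by (rule random_edge_finite[OF G P])
  hence finm: "finite (set_pmf m)" by (simp add: m_def)
  have posw: "(\<Prod>v\<leftarrow>w. x v) > 0" if "w \<in> set_pmf P" for w
    using pmf_positive[OF that] pmfP[OF random_edge_support(3)[OF P that]] b(2)
    by (simp add: zero_less_divide_iff)
  have pos: "x v > 0" if "w \<in> set_pmf P" "v \<in> set w" for w v
    using posw[OF that(1)] that(2) prod_list_pos_iff_nonneg[of x w] x(1) by blast
  have supm: "v \<in> V \<and> x v > 0" if "v \<in> set_pmf m" for v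
  proof -
    obtain w where w: "w \<in> set_pmf P" "v = hd w" using \<open>v \<in> set_pmf m\<close> by (auto simp: m_def)
    hence "v \<in> set w" using random_edge_support(1)[OF P w(1)] k by (cases w) auto
    thus ?thesis using pos[OF w(1)] random_edge_support(2)[OF P w(1)] by blast
  qed
  define L where "L = measure_pmf.expectation m (\<lambda>v. log 2 (x v))"
  have "shannon_entropy P = - measure_pmf.expectation P (\<lambda>w. log 2 (\<Prod>v\<leftarrow>w. x v) - log 2 b)"
    unfolding shannon_entropy_eq_expectation[OF finP] using posw b(2)
    by (intro arg_cong[of _ _ uminus] integral_cong_AE)
       (auto simp: AE_measure_pmf_iff pmfP[OF random_edge_support(3)[OF P]] log_divide_pos)
  also have "\<dots> = log 2 b - measure_pmf.expectation P (\<lambda>w. log 2 (\<Prod>v\<leftarrow>w. x v))"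
    using finP by (subst Bochner_Integration.integral_diff) (auto intro: integrable_measure_pmf_finite)
  also have "\<dots> = log 2 b - real k * L"
    using expectation_log_prod_random_edge[OF G P pos] by (simp add: L_def m_def)
  finally have HP: "shannon_entropy P = log 2 b - real k * L" .
  have "measure_pmf.expectation m (\<lambda>v. log 2 (x v powr p))
      = measure_pmf.expectation m (\<lambda>v. p * log 2 (x v))"
    by (intro integral_cong_AE) (auto simp: AE_measure_pmf_iff log_powr dest: supm)
  hence "shannon_entropy m + p * L = shannon_entropy m + measure_pmf.expectation m (\<lambda>v. log 2 (x v powr p))"
    by (simp add: L_def)
  also have "\<dots> \<le> log 2 (\<Sum>v\<in>set_pmf m. x v powr p)"
    using supm by (intro shannon_entropy_plus_expectation_log_le[OF finm]) fastforce
  also have "\<dots> \<le> 0"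
  proof -
    have "(\<Sum>v\<in>set_pmf m. x v powr p) \<le> (\<Sum>v\<in>V. x v powr p)"
      using supm G by (intro sum_mono2) (auto simp: k_graph_def)
    also have "\<dots> = 1" using lp_norm_eq_1_imp[OF p x(2)] x(1) by simp
    finally have "(\<Sum>v\<in>set_pmf m. x v powr p) \<le> 1" .
    moreover have "(\<Sum>v\<in>set_pmf m. x v powr p) > 0"
      using finm supm set_pmf_not_empty by (intro sum_pos) fastforce+
    ultimately show ?thesis by simp
  qed
  finally have "real k / p * (shannon_entropy m + p * L) \<le> 0"
    using p by (intro mult_nonneg_nonpos) auto
  hence "log 2 b \<le> shannon_entropy P - real k / p * shannon_entropy m"
    using p by (simp add: HP algebra_simps)
  hence "b \<le> 2 powr (shannon_entropy P - real k / p * shannon_entropy m)"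
    using b(2) by (simp add: log_le_iff)
  thus ?thesis using that P by (simp add: m_def)
qed


section \<open>Equality of the two maxima\<close>

theorem proposition5p4:
  fixes V :: "'v set" and E :: "'v set set" and k :: nat and p :: real
  assumes "k \<ge> 1" and "k_graph k V E" and "E \<noteq> {}" and "p > 0"
  shows "b_p_entropy p k V E = b_p p k V E"
proof (rule antisym)
  note bp = b_p_is_maximum[OF assms(2,3,1,4)]
  note be = b_p_entropy_is_maximum[OF assms(2,3), where p = p]
  obtain P where P: "random_edge_uniform_ordering k V E P" "b_p_entropy p k V E =
      2 powr (shannon_entropy P - real k / p * shannon_entropy (map_pmf hd P))"
    using be(1) by blast
  show le: "b_p_entropy p k V E \<le> b_p p k V E"
  proof -
    obtain z where z: "lp_norm p V z = 1"
      "b_p_entropy p k V E \<le> (\<Sum>vs\<in>ordered_edges k V E. \<Prod>v\<leftarrow>vs. z v)"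
      unfolding P(2) by (rule entropy_le_polynomial_at_marginal[OF assms(1,2,4) P(1)])
    from z(2) bp(2)[OF z(1)] show ?thesis by (rule order.trans)
  qed
  obtain x where x: "lp_norm p V x = 1"
    "b_p p k V E = (\<Sum>vs\<in>ordered_edges k V E. \<Prod>v\<leftarrow>vs. x v)"
    using bp(1) by blast
  \<comment> \<open>A maximiser may have entries of both signs; its absolute value is a maximiser as well.\<close>
  define y where "y = (\<lambda>v. \<bar>x v\<bar>)"
  define b where "b = (\<Sum>vs\<in>ordered_edges k V E. \<Prod>v\<leftarrow>vs. y v)"
  have y: "lp_norm p V y = 1" using x(1) by (simp add: lp_norm_def y_def)
  have "(\<Prod>v\<leftarrow>vs. x v) \<le> (\<Prod>v\<leftarrow>vs. y v)" for vs
  proof -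
    have "\<bar>\<Prod>v\<leftarrow>vs. x v\<bar> = (\<Prod>v\<leftarrow>vs. y v)" by (induction vs) (auto simp: y_def abs_mult)
    thus ?thesis by linarith
  qed
  hence b: "b_p p k V E \<le> b" unfolding x(2) b_def by (rule sum_mono)
  \<comment> \<open>Positivity of the polynomial maximum comes from the first inequality, as the entropic
    objective is a power of 2.\<close>
  have "b_p_entropy p k V E > 0" by (simp add: P(2))
  hence "b > 0" using le b by linarith
  moreover have "y v \<ge> 0" for v by (simp add: y_def)
  ultimately obtain Q where Q: "random_edge_uniform_ordering k V E Q"
    "b \<le> 2 powr (shannon_entropy Q - real k / p * shannon_entropy (map_pmf hd Q))"
    using polynomial_le_entropy_of_gibbs[OF assms(1,2,4) _ y b_def] by blast
  from b Q(2) have "b_p p k V E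
      \<le> 2 powr (shannon_entropy Q - real k / p * shannon_entropy (map_pmf hd Q))"
    by (rule order.trans)
  also have "\<dots> \<le> b_p_entropy p k V E" by (rule be(2)[OF Q(1)])
  finally show "b_p p k V E \<le> b_p_entropy p k V E" .
qed

end
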